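(* Let $N\ge2$, assume (A1)–(A5) of the context, and let $x^*$ be a local sharp minimizer of $\min_{x\in\mathcal X}f(x)$, i.e. $x^*$ is a minimizer of $f$ over $\mathcal X$ and there are constants $\beta>0$, $B>0$ with $$f(x)-\min_{\mathcal X} f\ge\beta\|x-x^*\|\quad\text{for all }x\in\mathcal X\text{ with }\|x-x^*\|\le B .$$ Let $\Lambda\in(\lambda,1)$ and $\Gamma\ge\sqrt2$ be any constants, and for initial points $x_{1,0},\dots,x_{N,0}$ define $$e_0:=\min\Big\{\max\Big\{\frac{\beta}{\rho\Gamma},\sqrt{\tfrac1N\sum_{i=1}^N\|x_{i,0}-x^*\|^2}\Big\},\frac{B}{\Gamma}\Big\},\qquad a:=\frac{2(L+\beta)L}{\lambda^2},$$ $$q:=\frac{2\beta}{\Gamma}e_0-\rho e_0^2-\frac{2(L+\beta)c}{\sqrt N\,\lambda}\|\Delta_0\| .$$ Suppose that the initial points satisfy, for all $i\in\{1,\dots,N\}$, $$\sum_{j=1}^N\|x_{j,0}-x^*\|^2\le\frac{N}{\Gamma^2}\min\Big\{\Big(\frac{2\beta}{\rho}\Big)^2,B^2\Big\},\qquad \|x_{i,0}-x^*\|^2\le\frac{\Gamma^2}{N}\sum_{j=1}^N\|x_{j,0}-x^*\|^2,$$ $$\|\Delta_0\|<\frac{\frac{2}{\Gamma}\beta e_0-\rho e_0^2}{2(L+\beta)c}\,\lambda ,$$ and that the stepsize is $\alpha_k=\mu_0\gamma^k$ with $\gamma\in(0,1)$ and $$0<\mu_0\le\min\Big\{\frac{e_0}{2\beta-\rho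 e_0},\ \frac{q}{10\sqrt N\big(a\lambda+L^2+\frac{ac\Lambda}{1-\Lambda}\big)}\Big\}.$$ Then there exists a sufficiently small $\delta>0$ such that for $\gamma=\lambda^\delta$, any sequence $\{x_{i,k}\}$ generated by $x_{i,k+1}=\mathrm{Proj}_{\mathcal X}(v_{i,k}-\alpha_k g_{i,k})$, $g_{i,k}\in\partial f_i(v_{i,k})$, satisfies for all $k\ge0$ $$\sum_{i=1}^N\|x_{i,k}-x^*\|^2\le N\gamma^{2k}e_0^2$$ and $$\|x_{i,k}-x^*\|^2\le\Gamma^2\gamma^{2k}e_0^2\quad\text{for all }i\in\{1,\dots,N\}.$$
   Context: Problem: $\min_{x\in\mathcal X} f(x)=\frac1N\sum_{i=1}^N f_i(x)$, where $\mathcal X\subset\mathbb{R}^n$ is a (nonempty) closed convex set and $f_i:\mathbb{R}^n\to\mathbb{R}$ is the objective of agent $i\in\mathcal V=\{1,\dots,N\}$. $\|\cdot\|$ is the Euclidean norm, $\mathrm{Proj}_{\mathcal X}$ the orthogonal projection onto $\mathcal X$. Weak convexity: $f_i$ is $\rho$-weakly convex ($\rho>0$) if $f_i=h_i-\frac{\rho}{2}\|\cdot\|^2$ for some convex $h_i$; then $\partial f_i(x):=\partial h_i(x)-\rho x$, with $\partial h_i$ the convex subdifferential. Network: at each time $k\ge0$, $(\mathcal V,E_k)$ is a directed graph and $A(k)=[a_{i,j}(k)]$ is an $N\times N$ matrix of nonnegative weights, where $a_{i,j}(k)$ is the weight agent $i$ gives to the information received from agent $j$, and $(j,i)\in E_k$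 iff $a_{i,j}(k)>0$. $\mathcal N_i(k)=\{j: a_{i,j}(k)>0\}$. Algorithm: initial points $x_{i,0}\in\mathcal X$; $v_{i,k}=\sum_{j\in\mathcal N_i(k)}a_{i,j}(k)x_{j,k}$; $x_{i,k+1}=\mathrm{Proj}_{\mathcal X}(v_{i,k}-\alpha_k g_{i,k})$, where $g_{i,k}$ is any element of $\partial f_i(v_{i,k})$ and $\alpha_k>0$ is the stepsize. Average: $\bar x_k=\frac1N\sum_{i=1}^N x_{i,k}$. $\Delta_k\in\mathbb{R}^{Nn}$ is the vector stacking all $\Delta_{k,i}=x_{i,k}-\bar x_k$, $i=1,\dots,N$. Assumptions: (A1) There is $\eta\in(0,1)$ such that for all $i,j$ and $k\ge0$: $a_{i,i}(k)\ge\eta$, and $a_{i,j}(k)>0$ implies $a_{i,j}(k)\ge\eta$. (A2) Each $A(k)$ is doubly stochastic. (A3) The graph $(\mathcal V,E_\infty)$ is strongly connected, where $E_\infty=\{(j,i):(j,i)\in E_k\text{ for infinitely many }k\}$. (A4) There is an integer $T_0\ge1$ such that for every $(j,i)\in E_\infty$ and every $k\ge0$, $(j,i)\in E_k\cup E_{k+1}\cup\dots\cup E_{k+T_0-1}$. (A5) $f$ is bounded below; every $f_i$ is $\rho$-weakly convex; and every element of $\partial f_i(x)$ has norm at most $L$, for all $x\in\mathcal X$ and all $i$. Constants $c,\lambda$: for $k\ge s$ let $\Phi(k,s)=A(k)A(k-1)\cdots A(s)$. Under (A1)–(A4) there exist constants $c>0$, $\lambda\in(0,1)$ with $\|\Phi(k,s)-\frac1N\mathbf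 1\mathbf 1^\top\|_{\mathrm{op}}\le c\lambda^{k-s}$ for all $k\ge s\ge 0$; $c,\lambda$ denote such constants. *)

theory Defs
  imports "HOL-Analysis.Analysis"
begin

text \<open>
  The agents are the elements of a finite type \<open>'v\<close>, so \<open>N = CARD('v)\<close>.  The iterates of all
  agents at one time form a vector \<open>x :: real^'n^'v\<close> with blocks \<open>x $ i\<close>; the norm of this type is
  the Euclidean norm of the stacked vector in dimension \<open>N n\<close>.
\<close>

subsection \<open>Weakly convex functions\<close>

definition weakly_convex :: "real \<Rightarrow> ('a::real_inner \<Rightarrow> real) \<Rightarrow> bool" where
  "weakly_convex \<rho> f \<longleftrightarrow>
     (\<exists>h. convex_on UNIV h \<and> (\<forall>x. f x = h x - \<rho> / 2 * (norm x)\<^sup>2))"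

definition convex_subdifferential :: "('a::real_inner \<Rightarrow> real) \<Rightarrow> 'a \<Rightarrow> 'a set" where
  "convex_subdifferential h x = {s. \<forall>y. h y \<ge> h x + s \<bullet> (y - x)}"

text \<open>The convex function \<open>h\<close> with \<open>f = h - \<rho>/2 \<parallel>\<cdot>\<parallel>\<^sup>2\<close> is determined by \<open>f\<close> and \<open>\<rho>\<close>.\<close>

definition weak_subdifferential :: "real \<Rightarrow> ('a::real_inner \<Rightarrow> real) \<Rightarrow> 'a \<Rightarrow> 'a set" where
  "weak_subdifferential \<rho> f x =
     {s - \<rho> *\<^sub>R x | s. s \<in> convex_subdifferential (\<lambda>y. f y + \<rho> / 2 * (norm y)\<^sup>2) x}"

subsection \<open>Objective and sharp minimizers\<close>

definition avg_objective :: "('v::finite \<Rightarrow> 'a \<Rightarrow> real) \<Rightarrow> 'a \<Rightarrow> real" where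
  "avg_objective F x = (1 / real CARD('v)) * (\<Sum>i\<in>UNIV. F i x)"

definition local_sharp_minimizer ::
    "('a::real_normed_vector \<Rightarrow> real) \<Rightarrow> 'a set \<Rightarrow> real \<Rightarrow> real \<Rightarrow> 'a \<Rightarrow> bool" where
  "local_sharp_minimizer f X \<beta> B xs \<longleftrightarrow>
     is_arg_min f (\<lambda>x. x \<in> X) xs \<and> \<beta> > 0 \<and> B > 0 \<and>
     (\<forall>x\<in>X. norm (x - xs) \<le> B \<longrightarrow> f x - (INF y\<in>X. f y) \<ge> \<beta> * norm (x - xs))"

subsection \<open>Communication network\<close>

text \<open>\<open>A k $ i $ j\<close> is the weight that \<open>i\<close> gives to \<open>j\<close>; the corresponding edge is \<open>(j, i)\<close>.\<close>

definition comm_edges :: "(nat \<Rightarrow> real^'v^'v) \<Rightarrow> nat \<Rightarrow> ('v \<times> 'v) set" where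
  "comm_edges A k = {(j, i). A k $ i $ j > 0}"

definition recurrent_edges :: "(nat \<Rightarrow> real^'v^'v) \<Rightarrow> ('v \<times> 'v) set" where
  "recurrent_edges A = {e. infinite {k. e \<in> comm_edges A k}}"

definition strongly_connected_on_UNIV :: "('v \<times> 'v) set \<Rightarrow> bool" where
  "strongly_connected_on_UNIV E \<longleftrightarrow> (\<forall>u v. (u, v) \<in> E\<^sup>*)"

definition doubly_stochastic :: "real^'v^'v::finite \<Rightarrow> bool" where
  "doubly_stochastic M \<longleftrightarrow>
     (\<forall>i j. M $ i $ j \<ge> 0) \<and>
     (\<forall>i. (\<Sum>j\<in>UNIV. M $ i $ j) = 1) \<and> (\<forall>j. (\<Sum>i\<in>UNIV. M $ i $ j) = 1)"

text \<open>\<open>transition_matrix A k s = A k ** A (k - 1) ** \<dots> ** A s\<close> for \<open>s \<le> k\<close>.\<close>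

definition transition_matrix :: "(nat \<Rightarrow> real^'v^'v::finite) \<Rightarrow> nat \<Rightarrow> nat \<Rightarrow> real^'v^'v" where
  "transition_matrix A k s = foldr (\<lambda>j M. A j ** M) (rev [s..<Suc k]) (mat 1)"

definition averaging_matrix :: "real^'v^'v::finite" where
  "averaging_matrix = (\<chi> i j. 1 / real CARD('v))"

subsection \<open>Distributed projected subgradient method\<close>

definition block_mean :: "'a::real_vector^'v::finite \<Rightarrow> 'a" where
  "block_mean x = (1 / real CARD('v)) *\<^sub>R (\<Sum>i\<in>UNIV. x $ i)"

definition consensus_error :: "'a::real_vector^'v::finite \<Rightarrow> 'a^'v" where
  "consensus_error x = (\<chi> i. x $ i - block_mean x)"

definition mixed_point :: "real^'v^'v \<Rightarrow> 'a::real_vector^'v::finite \<Rightarrow> 'v \<Rightarrow> 'a" where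
  "mixed_point M x i = (\<Sum>j\<in>{j. M $ i $ j > 0}. M $ i $ j *\<^sub>R x $ j)"

definition dpsm_sequence ::
    "(real^'n) set \<Rightarrow> (nat \<Rightarrow> real^'v^'v) \<Rightarrow> real \<Rightarrow> ('v::finite \<Rightarrow> real^'n \<Rightarrow> real) \<Rightarrow>
     (nat \<Rightarrow> real) \<Rightarrow> real^'n^'v \<Rightarrow> (nat \<Rightarrow> real^'n^'v) \<Rightarrow> bool" where
  "dpsm_sequence X A \<rho> F \<alpha> x0 x \<longleftrightarrow>
     x 0 = x0 \<and>
     (\<forall>k i. \<exists>g \<in> weak_subdifferential \<rho> (F i) (mixed_point (A k) (x k) i).
        x (Suc k) $ i = closest_point X (mixed_point (A k) (x k) i - \<alpha> k *\<^sub>R g))"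

end

theory Submission
  imports Defs
begin

text \<open>
  The proof is an induction on \<open>k\<close> that carries both bounds at once.  Write \<open>v\<^sub>i\<close> for the mixed
  points at time \<open>k\<close>, \<open>m\<close> for the mean of the agents, and \<open>R = \<Gamma> \<gamma>\<^sup>k e0\<close> for the radius in the second
  bound.

  Descent.  Mixing with a doubly stochastic matrix does not increase the sum of the squared
  distances to the minimizer.  In the projected subgradient step, weak convexity costs a factor
  \<open>1 + \<alpha> \<rho>\<close> and gains the sum of \<open>2 \<alpha> (f\<^sub>i(v\<^sub>i) - f\<^sub>i(x*))\<close>.  Each \<open>f\<^sub>i\<close> is \<open>L\<close>-Lipschitz on \<open>X\<close>
  (\<open>weakly_convex_lipschitz\<close>), so up to multiples of \<open>\<parallel>v\<^sub>i - m\<parallel>\<close> this gain is governed by sharpness at \<open>m\<close> and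
  is at least \<open>2 \<alpha> \<beta>\<close> times the sum of the \<open>\<parallel>v\<^sub>i - x*\<parallel>\<close>.  The second bound says that the \<open>v\<^sub>i\<close> lie in
  the ball of radius \<open>R\<close>, so \<open>\<parallel>v\<^sub>i - x*\<parallel> \<ge> \<parallel>v\<^sub>i - x*\<parallel>\<^sup>2 / R\<close>, and the gain contracts the squared
  distances (\<open>descent_step\<close>).  As \<open>\<alpha>\<close> and \<open>R\<close> both decay like \<open>\<gamma>\<^sup>k\<close>, the contraction factor does not
  deteriorate.

  Disagreement.  Unrolling the iteration and applying the mixing estimate to each perturbation
  (\<open>disagreement_bound\<close>) bounds the disagreement by a convolution of the powers of \<open>\<lambda>\<close> and \<open>\<gamma>\<close>.  For
  \<open>\<gamma> \<ge> \<lambda> / \<Lambda>\<close> it is at most a constant times \<open>\<gamma>\<^sup>k\<close> (\<open>geometric_convolution_le\<close>).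

  Rate.  The bounds on the initial disagreement and on \<open>\<mu>0\<close> leave a net decrease of at least
  \<open>9/10 \<mu>0 q\<close> per agent, relative to \<open>\<gamma>\<^sup>2\<^sup>k\<close>, so the sum contracts by \<open>\<gamma>\<^sup>2\<close> as soon as
  \<open>\<gamma>\<^sup>2 \<ge> 1 - 9/10 \<mu>0 q / e0\<^sup>2\<close> (\<open>squared_rate_margin\<close>).

  Single agents.  An agent is within the disagreement plus one subgradient step of the mean \<open>m\<close>,
  which is within \<open>\<gamma>\<^sup>k e0\<close> of \<open>x*\<close>.  Unless \<open>X\<close> is a single point, \<open>\<beta> \<le> L\<close> (\<open>sharpness_le_lipschitz\<close>), so
  these two terms together are at most \<open>11/20 \<gamma>\<^sup>k e0 / \<Gamma>\<close>, and \<open>\<Gamma> \<ge> \<surd>2\<close> leaves room for the factor \<open>\<gamma>\<close>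
  (\<open>agent_rate_margin\<close>).
\<close>

section \<open>Subgradients of weakly convex functions\<close>

text \<open>
  The strict epigraph of \<open>h\<close> is convex without any continuity argument, and a hyperplane
  separating it from \<open>(x, h x)\<close> cannot be vertical because \<open>h\<close> is finite everywhere.
\<close>

lemma convex_subdifferential_nonempty:
  fixes h :: "'a::euclidean_space \<Rightarrow> real"
  assumes h: "convex_on UNIV h"
  shows "convex_subdifferential h x \<noteq> {}"
proof -
  let ?S = "{(y, t). h y < t}"
  have convS: "convex ?S"
    unfolding convex_alt
  proof (clarsimp, goal_cases)
    case (1 y t z s u)
    have "h ((1 - u) *\<^sub>R y + u *\<^sub>R z) \<le> (1 - u) * h y + u * h z"
      using convex_onD[OF h, of u y z] 1 by simp
    also have "\<dots> < (1 - u) * t + u * s"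
    proof (cases "u = 0")
      case False
      then show ?thesis
        using 1 by (intro add_le_less_mono mult_left_mono mult_strict_left_mono) auto
    qed (use 1 in auto)
    finally show ?case .
  qed
  have "(x, h x + 1) \<in> ?S" by simp
  then have "?S \<noteq> {}" by blast
  then obtain w b where w: "w \<noteq> 0" "\<forall>p\<in>?S. w \<bullet> p \<le> b" "\<forall>p\<in>{(x, h x)}. b \<le> w \<bullet> p"
    using separating_hyperplane_sets[OF convS convex_singleton, of "(x, h x)"] by auto
  obtain u r where ur: "w = (u, r)" by force
  have sep: "u \<bullet> y + r * t \<le> u \<bullet> x + r * h x" if "h y < t" for y t
    using w(2)[rule_format, of "(y, t)"] w(3) that by (auto simp: ur)
  have "r \<noteq> 0"
  proof
    assume r: "r = 0"
    have "u \<bullet> (x + u) \<le> u \<bullet> x"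
      using sep[of "x + u" "h (x + u) + 1"] r by simp
    then have "u = 0" by (simp add: inner_right_distrib flip: inner_gt_zero_iff)
       (metis inner_gt_zero_iff not_less)
    with w(1) ur r show False by (simp add: zero_prod_def)
  qed
  moreover have "r \<le> 0" using sep[of x "h x + 1"] by (simp add: algebra_simps)
  ultimately have r: "r < 0" by simp
  have "h y \<ge> h x + (- (1 / r) *\<^sub>R u) \<bullet> (y - x)" for y
  proof (rule field_le_epsilon)
    fix e :: real assume "0 < e"
    then have "u \<bullet> y + r * (h y + e) \<le> u \<bullet> x + r * h x" by (intro sep) simp
    then have "u \<bullet> (y - x) \<le> (- r) * (h y + e - h x)"
      by (simp add: inner_diff_right algebra_simps)
    then have "u \<bullet> (y - x) / (- r) \<le> h y + e - h x"
      using r by (subst pos_divide_le_eq) (simp_all add: mult.commute)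
    then show "h x + (- (1 / r) *\<^sub>R u) \<bullet> (y - x) \<le> h y + e"
      by simp
  qed
  then show ?thesis unfolding convex_subdifferential_def by blast
qed

lemma weak_subdifferential_nonempty:
  fixes f :: "'a::euclidean_space \<Rightarrow> real"
  assumes "weakly_convex \<rho> f"
  shows "weak_subdifferential \<rho> f x \<noteq> {}"
proof -
  obtain h where h: "convex_on UNIV h" "\<And>x. f x = h x - \<rho> / 2 * (norm x)\<^sup>2"
    using assms unfolding weakly_convex_def by blast
  have "(\<lambda>y. f y + \<rho> / 2 * (norm y)\<^sup>2) = h" using h(2) by auto
  then show ?thesis
    using convex_subdifferential_nonempty[OF h(1), of x]
    unfolding weak_subdifferential_def by auto
qed

lemma weak_subgradient_inequality:
  fixes f :: "'a::real_inner \<Rightarrow> real"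
  assumes "g \<in> weak_subdifferential \<rho> f x"
  shows "f y \<ge> f x + g \<bullet> (y - x) - \<rho> / 2 * (norm (y - x))\<^sup>2"
proof -
  obtain s where s: "g = s - \<rho> *\<^sub>R x"
    and ineq: "f y + \<rho> / 2 * (norm y)\<^sup>2 \<ge> f x + \<rho> / 2 * (norm x)\<^sup>2 + s \<bullet> (y - x)"
    using assms unfolding weak_subdifferential_def convex_subdifferential_def by blast
  have "\<rho> / 2 * (norm (y - x))\<^sup>2 = \<rho> / 2 * (norm y)\<^sup>2 - \<rho> / 2 * (norm x)\<^sup>2 - \<rho> * (x \<bullet> (y - x))"
    unfolding power2_norm_eq_inner
    by (simp add: inner_diff_left inner_diff_right inner_commute algebra_simps)
  then show ?thesis using ineq by (simp add: s inner_diff_left algebra_simps)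
qed

text \<open>
  A single subgradient only gives the Lipschitz estimate up to the quadratic error
  \<open>\<rho> / 2 * (norm (y - x))\<^sup>2\<close>.  Cutting the segment from \<open>x\<close> to \<open>y\<close> into \<open>m\<close> equal pieces and
  using a subgradient at each division point divides this error by \<open>m\<close>.
\<close>

lemma weakly_convex_lipschitz:
  fixes f :: "'a::euclidean_space \<Rightarrow> real"
  assumes X: "convex X" and f: "weakly_convex \<rho> f" and \<rho>: "\<rho> \<ge> 0"
    and L: "\<And>z g. z \<in> X \<Longrightarrow> g \<in> weak_subdifferential \<rho> f z \<Longrightarrow> norm g \<le> L"
    and xy: "x \<in> X" "y \<in> X"
  shows "f x - L * norm (y - x) \<le> f y"
proof -
  let ?d = "norm (y - x)"
  have part: "f x - L * ?d - (\<rho> / 2 * ?d\<^sup>2) / real m \<le> f y" if m: "m > 0" for m :: nat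
  proof -
    define z where "z j = x + (real j / real m) *\<^sub>R (y - x)" for j
    have zX: "z j \<in> X" if "j \<le> m" for j
    proof -
      have "z j = (1 - real j / real m) *\<^sub>R x + (real j / real m) *\<^sub>R y"
        by (simp add: z_def algebra_simps)
      then show ?thesis using X xy that m by (auto intro!: convexD)
    qed
    define e where "e = L * ?d / m + \<rho> / 2 * ?d\<^sup>2 / (real m)\<^sup>2"
    have inc: "f (z j) - e \<le> f (z (Suc j))" if j: "j < m" for j
    proof -
      obtain g where g: "g \<in> weak_subdifferential \<rho> f (z j)"
        using weak_subdifferential_nonempty[OF f] by blast
      have dz: "z (Suc j) - z j = (1 / real m) *\<^sub>R (y - x)"
        by (simp add: z_def add_divide_distrib algebra_simps)
      then have nz: "norm (z (Suc j) - z j) = ?d / real m" by simp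
      have "\<bar>g \<bullet> (z (Suc j) - z j)\<bar> \<le> norm g * (?d / m)"
        using Cauchy_Schwarz_ineq2[of g "z (Suc j) - z j"] nz by simp
      also have "\<dots> \<le> L * (?d / m)"
        using L[OF zX g] j by (intro mult_right_mono) auto
      finally show ?thesis
        using weak_subgradient_inequality[OF g, of "z (Suc j)"]
        by (simp add: nz power_divide e_def)
    qed
    have "f x - real j * e \<le> f (z j)" if "j \<le> m" for j
      using that
    proof (induction j)
      case 0
      then show ?case by (simp add: z_def)
    next
      case (Suc j)
      then show ?case using inc[of j] by (simp add: algebra_simps)
    qed
    moreover have "real m * e = L * ?d + (\<rho> / 2 * ?d\<^sup>2) / real m" "z m = y"
      using m by (simp_all add: z_def e_def power2_eq_square distrib_left)
    ultimately show ?thesis by (metis diff_diff_eq order_refl)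
  qed
  have "(\<lambda>m. f x - L * ?d - (\<rho> / 2 * ?d\<^sup>2) / real m) \<longlonglongrightarrow> f x - L * ?d - 0"
    by (intro tendsto_diff tendsto_const lim_const_over_n)
  then have "f x - L * ?d - 0 \<le> f y"
    by (rule LIMSEQ_le_const2) (use part in \<open>auto intro!: exI[of _ 1]\<close>)
  then show ?thesis by simp
qed

text \<open>
  In the degenerate case \<open>X = {xs}\<close> the growth condition says nothing about \<open>\<beta>\<close>; otherwise
  convexity provides points of \<open>X\<close> close to \<open>xs\<close> at which both bounds apply.
\<close>

lemma sharpness_le_lipschitz:
  fixes f :: "'a::real_normed_vector \<Rightarrow> real"
  assumes X: "convex X" "xs \<in> X" "X \<noteq> {xs}" and B: "B > 0"
    and sharp: "\<And>x. x \<in> X \<Longrightarrow> norm (x - xs) \<le> B \<Longrightarrow> \<beta> * norm (x - xs) \<le> f x - f xs"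
    and lip: "\<And>x. x \<in> X \<Longrightarrow> f x - f xs \<le> L * norm (x - xs)"
  shows "\<beta> \<le> L"
proof -
  obtain y where y: "y \<in> X" "y \<noteq> xs" using X by blast
  define t where "t = min 1 (B / norm (y - xs))"
  define z where "z = (1 - t) *\<^sub>R xs + t *\<^sub>R y"
  have t: "0 < t" "t \<le> 1" "t * norm (y - xs) \<le> B"
    using B y by (auto simp: t_def min_def field_simps)
  have zX: "z \<in> X" unfolding z_def using t X y by (intro convexD) auto
  have "z - xs = t *\<^sub>R (y - xs)" by (simp add: z_def algebra_simps)
  then have nz: "norm (z - xs) = t * norm (y - xs)" using t by simp
  then have "0 < norm (z - xs)" "norm (z - xs) \<le> B" using t y by auto
  then show ?thesis
    using sharp[OF zX] lip[OF zX] by (meson mult_le_cancel_right_pos order_trans)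
qed

section \<open>Mixing by doubly stochastic matrices\<close>

lemma norm_convex_combination_squared:
  fixes d :: "'i \<Rightarrow> 'a::real_normed_vector"
  assumes I: "finite I" and w: "\<And>j. j \<in> I \<Longrightarrow> w j \<ge> 0" "sum w I = 1"
  shows "(norm (\<Sum>j\<in>I. w j *\<^sub>R d j))\<^sup>2 \<le> (\<Sum>j\<in>I. w j * (norm (d j))\<^sup>2)"
proof -
  have "norm (\<Sum>j\<in>I. w j *\<^sub>R d j) \<le> (\<Sum>j\<in>I. w j * norm (d j))"
    using w(1) by (intro sum_norm_le) auto
  then have "(norm (\<Sum>j\<in>I. w j *\<^sub>R d j))\<^sup>2 \<le> (\<Sum>j\<in>I. w j *\<^sub>R norm (d j))\<^sup>2"
    by (intro power_mono) auto
  also have "\<dots> \<le> (\<Sum>j\<in>I. w j * (norm (d j))\<^sup>2)"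
    using w I by (intro convex_on_sum[OF _ _ convex_power2]) auto
  finally show ?thesis .
qed

text \<open>
  A real matrix acts on a vector of blocks by \<open>M \<otimes> I\<close>: block \<open>i\<close> of the result is the combination
  of the blocks of \<open>x\<close> with the weights in row \<open>i\<close> of \<open>M\<close>.
\<close>
definition block_mult :: "real^'v^'u \<Rightarrow> 'a::real_vector^'v \<Rightarrow> 'a^'u" where
  "block_mult M x = (\<chi> i. \<Sum>j\<in>UNIV. M $ i $ j *\<^sub>R x $ j)"

lemma block_mult_nth [simp]: "block_mult M x $ i = (\<Sum>j\<in>UNIV. M $ i $ j *\<^sub>R x $ j)"
  by (simp add: block_mult_def)

lemma block_mult_add: "block_mult M (x + y) = block_mult M x + block_mult M y"
  by (simp add: vec_eq_iff scaleR_add_right sum.distrib)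

lemma block_mult_diff_matrix: "block_mult (M - M') x = block_mult M x - block_mult M' x"
  by (simp add: vec_eq_iff scaleR_diff_left sum_subtractf)

lemma block_mult_sum: "block_mult M (\<Sum>l\<in>S. x l) = (\<Sum>l\<in>S. block_mult M (x l))"
  by (induction S rule: infinite_finite_induct) (auto simp: block_mult_add vec_eq_iff)

lemma block_mult_assoc: "block_mult M (block_mult M' x) = block_mult (M ** M') x"
proof -
  have "(\<Sum>j\<in>UNIV. M $ i $ j *\<^sub>R (\<Sum>k\<in>UNIV. M' $ j $ k *\<^sub>R x $ k))
      = (\<Sum>k\<in>UNIV. (\<Sum>j\<in>UNIV. M $ i $ j * M' $ j $ k) *\<^sub>R x $ k)" for i
    unfolding scaleR_sum_right scaleR_sum_left by (subst sum.swap) simp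
  then show ?thesis by (simp add: vec_eq_iff matrix_matrix_mult_def)
qed

lemma block_mult_mat_1 [simp]: "block_mult (mat 1) x = x"
  by (simp add: vec_eq_iff mat_def if_distrib [of "\<lambda>r. r *\<^sub>R _"] cong: if_cong)

lemma norm_vec_power2: "(norm (x :: 'a::real_normed_vector^'v::finite))\<^sup>2 = (\<Sum>i\<in>UNIV. (norm (x $ i))\<^sup>2)"
  by (simp add: norm_vec_def L2_set_def sum_nonneg)

text \<open>
  In each coordinate \<open>b\<close> of the blocks, \<open>M\<close> acts as an ordinary matrix on the vector of the
  \<open>b\<close>-coordinates; hence \<open>M \<otimes> I\<close> is bounded by the operator norm of \<open>M\<close>.
\<close>

lemma norm_block_mult_le:
  fixes M :: "real^'v^'u" and x :: "'a::euclidean_space^'v"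
  shows "norm (block_mult M x) \<le> onorm ((*v) M) * norm x"
proof (rule power2_le_imp_le)
  let ?K = "onorm ((*v) M)"
  have K: "bounded_linear ((*v) M)" by simp
  define c where "c b = (\<chi> j. x $ j \<bullet> b)" for b
  have nrm: "(norm (y $ i))\<^sup>2 = (\<Sum>b\<in>Basis. (y $ i \<bullet> b)\<^sup>2)" for y :: "'a^'w" and i
    by (subst power2_norm_eq_inner, subst euclidean_inner) (simp add: power2_eq_square)
  have "(norm (block_mult M x))\<^sup>2 = (\<Sum>i\<in>UNIV. \<Sum>b\<in>Basis. (block_mult M x $ i \<bullet> b)\<^sup>2)"
    by (simp only: norm_vec_power2 nrm)
  also have "\<dots> = (\<Sum>b\<in>Basis. (norm (M *v c b))\<^sup>2)"
    by (subst sum.swap)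
       (simp add: norm_vec_power2 c_def matrix_vector_mult_def inner_sum_left)
  also have "\<dots> \<le> (\<Sum>b\<in>Basis. (?K * norm (c b))\<^sup>2)"
    by (intro sum_mono power_mono onorm[OF K]) auto
  also have "\<dots> = ?K\<^sup>2 * (\<Sum>b\<in>Basis. \<Sum>j\<in>UNIV. (x $ j \<bullet> b)\<^sup>2)"
    by (simp add: power_mult_distrib norm_vec_power2 c_def sum_distrib_left)
  also have "\<dots> = (?K * norm x)\<^sup>2"
    by (subst sum.swap) (simp add: power_mult_distrib norm_vec_power2 nrm)
  finally show "(norm (block_mult M x))\<^sup>2 \<le> (?K * norm x)\<^sup>2" .
  show "0 \<le> ?K * norm x" using onorm_pos_le[OF K] by simp
qed


section \<open>Disagreement of the agents\<close>

lemma transition_matrix_Suc: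
  assumes "s \<le> Suc k"
  shows "transition_matrix A (Suc k) s = A (Suc k) ** transition_matrix A k s"
  using assms by (simp add: transition_matrix_def)

lemma transition_matrix_empty [simp]: "transition_matrix A k (Suc k) = mat 1"
  by (simp add: transition_matrix_def)

lemma transition_matrix_self [simp]: "transition_matrix A k k = A k"
  by (simp add: transition_matrix_def)

text \<open>
  Variation of constants for the perturbed averaging iteration, read off after the mixing step.
  Thus \<open>p l\<close> is propagated by \<open>A k ** \<dots> ** A (Suc l)\<close>.
\<close>

lemma block_trajectory:
  assumes step: "\<And>k. x (Suc k) = block_mult (A k) (x k) + p k"
  shows "block_mult (A k) (x k) = block_mult (transition_matrix A k 0) (x 0)
           + (\<Sum>l<k. block_mult (transition_matrix A k (Suc l)) (p l))"
proof (induction k)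
  case 0
  then show ?case by simp
next
  case (Suc k)
  show ?case
    unfolding step Suc block_mult_add block_mult_sum block_mult_assoc
    by (simp add: transition_matrix_Suc)
qed

lemma averaging_matrix_mult_doubly_stochastic:
  assumes "doubly_stochastic M"
  shows "averaging_matrix ** M = averaging_matrix"
  using assms
  by (simp add: vec_eq_iff matrix_matrix_mult_def averaging_matrix_def doubly_stochastic_def
      flip: sum_divide_distrib)

lemma doubly_stochastic_averaging_matrix: "doubly_stochastic averaging_matrix"
  by (simp add: doubly_stochastic_def averaging_matrix_def)

lemma block_mult_averaging_matrix: "block_mult averaging_matrix x $ i = block_mean x"
  by (simp add: averaging_matrix_def block_mean_def scaleR_sum_right)

lemma block_mult_shift:
  assumes "doubly_stochastic M"
  shows "block_mult M (\<chi> i. x $ i - z) = block_mult M x - (\<chi> i. z)"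
  using assms
  by (simp add: vec_eq_iff doubly_stochastic_def scaleR_diff_right sum_subtractf
      flip: scaleR_sum_left)

lemma mixed_point_eq_block_mult:
  assumes "doubly_stochastic M"
  shows "mixed_point M x i = block_mult M x $ i"
proof -
  have "M $ i $ j = 0" if "\<not> M $ i $ j > 0" for j
  proof -
    have "M $ i $ j \<ge> 0" using assms unfolding doubly_stochastic_def by blast
    then show ?thesis using that by simp
  qed
  then show ?thesis
    unfolding mixed_point_def block_mult_nth by (intro sum.mono_neutral_left) auto
qed

lemma disagreement_from_origin:
  fixes x p :: "nat \<Rightarrow> 'a::euclidean_space^'v::finite"
  assumes ds: "\<And>k. doubly_stochastic (A k)"
    and mixing: "\<And>s k. s \<le> k \<Longrightarrow>
      onorm ((*v) (transition_matrix A k s - averaging_matrix)) \<le> c * lam ^ (k - s)"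
    and step: "\<And>k. x (Suc k) = block_mult (A k) (x k) + p k"
  shows "norm (block_mult (A k) (x k) - block_mult averaging_matrix (x k))
           \<le> c * lam ^ k * norm (x 0) + (\<Sum>l<k. c * lam ^ (k - Suc l) * norm (p l))"
proof -
  let ?J = "averaging_matrix :: real^'v^'v"
  let ?P = "transition_matrix A k"
  have mean: "block_mult ?J (x k) = block_mult ?J (x 0) + (\<Sum>l<k. block_mult ?J (p l))" for k
  proof (induction k)
    case 0
    then show ?case by simp
  next
    case (Suc k)
    then show ?case
      by (simp add: step block_mult_add block_mult_assoc averaging_matrix_mult_doubly_stochastic ds
          add.assoc)
  qed
  have bnd: "norm (block_mult (?P s - ?J) z) \<le> c * lam ^ (k - s) * norm z" if "s \<le> k"
    for s and z :: "'a^'v"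
    using norm_block_mult_le[of "?P s - ?J" z] mult_right_mono[OF mixing[OF that] norm_ge_zero[of z]]
    by linarith
  have "block_mult (A k) (x k) - block_mult ?J (x k)
      = block_mult (?P 0 - ?J) (x 0) + (\<Sum>l<k. block_mult (?P (Suc l) - ?J) (p l))"
    by (simp add: block_trajectory[where x = x, OF step] mean[of k] block_mult_diff_matrix sum_subtractf)
  also have "norm \<dots> \<le> c * lam ^ k * norm (x 0) + (\<Sum>l<k. c * lam ^ (k - Suc l) * norm (p l))"
    using bnd[of 0 "x 0"] by (intro norm_triangle_le add_mono sum_norm_le) (auto intro: bnd)
  finally show ?thesis .
qed

text \<open>
  Row-stochastic matrices commute with translating all agents by the same vector.  Translating by
  the initial mean replaces the initial norm in the previous bound by the initial disagreement.
\<close>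

lemma disagreement_bound:
  fixes x p :: "nat \<Rightarrow> 'a::euclidean_space^'v::finite"
  assumes ds: "\<And>k. doubly_stochastic (A k)"
    and mixing: "\<And>s k. s \<le> k \<Longrightarrow>
      onorm ((*v) (transition_matrix A k s - averaging_matrix)) \<le> c * lam ^ (k - s)"
    and step: "\<And>k. x (Suc k) = block_mult (A k) (x k) + p k"
  shows "norm (block_mult (A k) (x k) - block_mult averaging_matrix (x k))
           \<le> c * lam ^ k * norm (consensus_error (x 0))
             + (\<Sum>l<k. c * lam ^ (k - Suc l) * norm (p l))"
proof -
  define y where "y k = (\<chi> i. x k $ i - block_mean (x 0))" for k
  have "y (Suc k) = block_mult (A k) (y k) + p k" for k
    unfolding y_def block_mult_shift[OF ds] by (simp add: step vec_eq_iff)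
  from disagreement_from_origin[where x = y, OF ds mixing this] show ?thesis
    unfolding y_def block_mult_shift[OF ds]
      block_mult_shift[OF doubly_stochastic_averaging_matrix]
    by (simp add: consensus_error_def)
qed

lemma geometric_convolution_le:
  fixes lam \<gamma> Lam :: real
  assumes "0 \<le> lam" "0 < \<gamma>" "lam \<le> Lam * \<gamma>" "Lam < 1"
  shows "(\<Sum>l<k. lam ^ (k - Suc l) * \<gamma> ^ l) \<le> \<gamma> ^ k / (\<gamma> * (1 - Lam))"
proof (induction k)
  case 0
  then show ?case using assms by simp
next
  case (Suc k)
  let ?T = "\<Sum>l<k. lam ^ (k - Suc l) * \<gamma> ^ l"
  have "(\<Sum>l<Suc k. lam ^ (Suc k - Suc l) * \<gamma> ^ l) = lam * ?T + \<gamma> ^ k"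
    by (auto simp: sum_distrib_left mult.assoc Suc_diff_Suc simp flip: power_Suc
        intro!: sum.cong)
  also have "\<dots> \<le> (Lam * \<gamma>) * (\<gamma> ^ k / (\<gamma> * (1 - Lam))) + \<gamma> ^ k"
    using assms Suc by (intro add_mono mult_mono order_refl) (auto intro!: sum_nonneg)
  also have "\<dots> = \<gamma> ^ Suc k / (\<gamma> * (1 - Lam))"
    using assms by (simp add: field_simps)
  finally show ?case .
qed

lemma sum_norm_blocks_le:
  fixes x :: "'a::real_normed_vector^'v::finite"
  shows "(\<Sum>i\<in>UNIV. norm (x $ i)) \<le> sqrt (real CARD('v)) * norm x"
proof (rule power2_le_imp_le)
  show "(\<Sum>i\<in>UNIV. norm (x $ i))\<^sup>2 \<le> (sqrt (real CARD('v)) * norm x)\<^sup>2"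
    using sum_squared_le_sum_of_squares[of "\<lambda>i. norm (x $ i)" UNIV]
    by (simp add: power_mult_distrib norm_vec_power2 mult.commute)
qed simp

lemma norm_vec_le_of_blocks:
  fixes x :: "'a::real_normed_vector^'v::finite"
  assumes "\<And>i. norm (x $ i) \<le> r"
  shows "norm x \<le> sqrt (real CARD('v)) * r"
proof (rule power2_le_imp_le)
  have r: "0 \<le> r" using assms[of undefined] norm_ge_zero order_trans by blast
  have "(norm x)\<^sup>2 \<le> (\<Sum>i\<in>(UNIV :: 'v set). r\<^sup>2)"
    unfolding norm_vec_power2 by (intro sum_mono power_mono assms) auto
  then show "(norm x)\<^sup>2 \<le> (sqrt (real CARD('v)) * r)\<^sup>2" by (simp add: power_mult_distrib)
  show "0 \<le> sqrt (real CARD('v)) * r" using r by simp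
qed

lemma sum_block_mult_distance_le:
  fixes x :: "'a::real_normed_vector^'v::finite"
  assumes M: "doubly_stochastic M"
  shows "(\<Sum>i\<in>UNIV. (norm (block_mult M x $ i - z))\<^sup>2) \<le> (\<Sum>i\<in>UNIV. (norm (x $ i - z))\<^sup>2)"
proof -
  have "(norm (block_mult M x $ i - z))\<^sup>2 \<le> (\<Sum>j\<in>UNIV. M $ i $ j * (norm (x $ j - z))\<^sup>2)" for i
  proof -
    have "block_mult M x $ i - z = (\<Sum>j\<in>UNIV. M $ i $ j *\<^sub>R (x $ j - z))"
      using arg_cong[OF block_mult_shift[OF M, of x z], of "\<lambda>v. v $ i"] by simp
    then show ?thesis
      using M norm_convex_combination_squared[of UNIV "\<lambda>j. M $ i $ j" "\<lambda>j. x $ j - z"]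
      by (simp add: doubly_stochastic_def)
  qed
  then have "(\<Sum>i\<in>UNIV. (norm (block_mult M x $ i - z))\<^sup>2)
      \<le> (\<Sum>i\<in>UNIV. \<Sum>j\<in>UNIV. M $ i $ j * (norm (x $ j - z))\<^sup>2)"
    by (intro sum_mono)
  also have "\<dots> = (\<Sum>j\<in>UNIV. (\<Sum>i\<in>UNIV. M $ i $ j) * (norm (x $ j - z))\<^sup>2)"
    by (subst sum.swap) (simp add: sum_distrib_right)
  finally show ?thesis using M by (simp add: doubly_stochastic_def)
qed

lemma block_mult_mem_convex:
  fixes x :: "'a::real_vector^'v::finite"
  assumes "doubly_stochastic M" "convex C" "\<And>j. x $ j \<in> C"
  shows "block_mult M x $ i \<in> C"
  using assms unfolding block_mult_nth doubly_stochastic_def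
  by (intro convex_sum) auto

lemma block_mean_distance_le:
  fixes x :: "'a::real_normed_vector^'v::finite"
  shows "real CARD('v) * (norm (block_mean x - z))\<^sup>2 \<le> (\<Sum>i\<in>UNIV. (norm (x $ i - z))\<^sup>2)"
  using sum_block_mult_distance_le[OF doubly_stochastic_averaging_matrix, of x z]
  by (simp only: block_mult_averaging_matrix) simp

section \<open>One step of the method\<close>

text \<open>
  The reference point \<open>w\<close> stands for the mean of the agents.  Sharpness is linear in the distance
  to \<open>xs\<close>; on the ball of radius \<open>R\<close> a distance is at least its square divided by \<open>R\<close>, which
  turns the linear gain into a contraction of the squared distances.
\<close>

lemma descent_step:
  fixes F :: "'v::finite \<Rightarrow> 'a::euclidean_space \<Rightarrow> real"
  assumes X: "closed X" "convex X"
    and wc: "\<And>i. weakly_convex \<rho> (F i)" and \<rho>: "\<rho> \<ge> 0"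
    and L: "\<And>i z g. z \<in> X \<Longrightarrow> g \<in> weak_subdifferential \<rho> (F i) z \<Longrightarrow> norm g \<le> L"
    and pts: "xs \<in> X" "w \<in> X" "\<And>i. v i \<in> X"
    and g: "\<And>i. g i \<in> weak_subdifferential \<rho> (F i) (v i)"
    and y: "\<And>i. y i = closest_point X (v i - \<alpha> *\<^sub>R g i)"
    and pos: "\<alpha> \<ge> 0" "\<beta> \<ge> 0" "R > 0"
    and sharp: "\<beta> * norm (w - xs) \<le> avg_objective F w - avg_objective F xs"
    and R: "\<And>i. norm (v i - xs) \<le> R"
  shows "(\<Sum>i\<in>UNIV. (norm (y i - xs))\<^sup>2)
      \<le> (1 + \<alpha> * \<rho> - 2 * \<alpha> * \<beta> / R) * (\<Sum>i\<in>UNIV. (norm (v i - xs))\<^sup>2)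
        + 2 * \<alpha> * (L + \<beta>) * (\<Sum>i\<in>UNIV. norm (v i - w)) + real CARD('v) * (\<alpha>\<^sup>2 * L\<^sup>2)"
proof -
  have agent: "(norm (y i - xs))\<^sup>2 \<le> (1 + \<alpha> * \<rho>) * (norm (v i - xs))\<^sup>2
      - 2 * \<alpha> * (F i w - F i xs) + 2 * \<alpha> * L * norm (v i - w) + \<alpha>\<^sup>2 * L\<^sup>2" for i
  proof -
    have "norm (y i - xs) \<le> norm (v i - \<alpha> *\<^sub>R g i - xs)"
      using closest_point_lipschitz[of X "v i - \<alpha> *\<^sub>R g i" xs] X pts
      by (auto simp: y closest_point_self dist_norm)
    then have "(norm (y i - xs))\<^sup>2 \<le> (norm ((v i - xs) - \<alpha> *\<^sub>R g i))\<^sup>2"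
      by (intro power_mono) (simp_all add: algebra_simps)
    also have "\<dots> = (norm (v i - xs))\<^sup>2 + 2 * \<alpha> * (g i \<bullet> (xs - v i)) + \<alpha>\<^sup>2 * (norm (g i))\<^sup>2"
      unfolding power2_norm_eq_inner
      by (simp add: inner_diff_left inner_diff_right inner_commute power2_eq_square algebra_simps)
    finally have 1: "(norm (y i - xs))\<^sup>2
      \<le> (norm (v i - xs))\<^sup>2 + 2 * \<alpha> * (g i \<bullet> (xs - v i)) + \<alpha>\<^sup>2 * (norm (g i))\<^sup>2" .
    have "F i (v i) + g i \<bullet> (xs - v i) - \<rho> / 2 * (norm (v i - xs))\<^sup>2 \<le> F i xs"
      using weak_subgradient_inequality[OF g, of i xs] by (simp add: norm_minus_commute)
    moreover have "F i w - L * norm (v i - w) \<le> F i (v i)"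
      by (rule weakly_convex_lipschitz[OF X(2) wc \<rho>]) (auto intro: L pts)
    ultimately have "2 * \<alpha> * (g i \<bullet> (xs - v i))
        \<le> 2 * \<alpha> * (\<rho> / 2 * (norm (v i - xs))\<^sup>2 - (F i w - F i xs) + L * norm (v i - w))"
      using pos by (intro mult_left_mono) auto
    moreover have "\<alpha>\<^sup>2 * (norm (g i))\<^sup>2 \<le> \<alpha>\<^sup>2 * L\<^sup>2"
      using L[OF pts(3) g] by (intro mult_left_mono power_mono) auto
    ultimately show ?thesis using 1 by (simp add: algebra_simps)
  qed
  have near: "(norm (v i - xs))\<^sup>2 / R \<le> norm (w - xs) + norm (v i - w)" for i
  proof -
    have "(norm (v i - xs))\<^sup>2 \<le> R * norm (v i - xs)"
      unfolding power2_eq_square using R by (intro mult_right_mono) auto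
    then have "(norm (v i - xs))\<^sup>2 / R \<le> norm (v i - xs)"
      using pos by (simp add: pos_divide_le_eq mult.commute)
    also have "\<dots> \<le> norm (w - xs) + norm (v i - w)"
      using norm_triangle_ineq[of "w - xs" "v i - w"] by simp
    finally show ?thesis .
  qed
  have "\<beta> * (\<Sum>i\<in>UNIV. (norm (v i - xs))\<^sup>2) / R = (\<Sum>i\<in>UNIV. \<beta> * ((norm (v i - xs))\<^sup>2 / R))"
    by (simp add: sum_distrib_left sum_divide_distrib)
  also have "\<dots> \<le> (\<Sum>i\<in>UNIV. \<beta> * (norm (w - xs) + norm (v i - w)))"
    using near pos by (intro sum_mono mult_left_mono) auto
  also have "\<dots> = real CARD('v) * (\<beta> * norm (w - xs)) + \<beta> * (\<Sum>i\<in>UNIV. norm (v i - w))"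
    by (simp add: sum.distrib distrib_left sum_distrib_left)
  also have "real CARD('v) * (\<beta> * norm (w - xs))
      \<le> real CARD('v) * (avg_objective F w - avg_objective F xs)"
    using sharp by (intro mult_left_mono) auto
  also have "\<dots> = (\<Sum>i\<in>UNIV. F i w - F i xs)"
    by (simp add: avg_objective_def sum_subtractf right_diff_distrib)
  finally have gap: "\<beta> * (\<Sum>i\<in>UNIV. (norm (v i - xs))\<^sup>2) / R - \<beta> * (\<Sum>i\<in>UNIV. norm (v i - w))
      \<le> (\<Sum>i\<in>UNIV. F i w - F i xs)"
    by simp
  have "(\<Sum>i\<in>UNIV. (norm (y i - xs))\<^sup>2) \<le> (\<Sum>i\<in>UNIV. (1 + \<alpha> * \<rho>) * (norm (v i - xs))\<^sup>2
      - 2 * \<alpha> * (F i w - F i xs) + 2 * \<alpha> * L * norm (v i - w) + \<alpha>\<^sup>2 * L\<^sup>2)"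
    by (intro sum_mono agent)
  also have "\<dots> = (1 + \<alpha> * \<rho>) * (\<Sum>i\<in>UNIV. (norm (v i - xs))\<^sup>2)
      - 2 * \<alpha> * (\<Sum>i\<in>UNIV. F i w - F i xs) + 2 * \<alpha> * L * (\<Sum>i\<in>UNIV. norm (v i - w))
      + real CARD('v) * (\<alpha>\<^sup>2 * L\<^sup>2)"
    by (simp add: sum.distrib sum_subtractf flip: sum_distrib_left)
  finally show ?thesis
    using mult_left_mono[OF gap, of "2 * \<alpha>"] pos by (simp add: algebra_simps)
qed


section \<open>Choice of the rate\<close>

text \<open>
  The next two inequalities close the induction for the sum of the squared distances and for the
  single agents.  Here \<open>s\<close> is the square root of the number of agents, \<open>u = c / (1 - Lam)\<close>, \<open>D\<close> is the
  initial disagreement, \<open>\<gamma> ^ k * E\<close> bounds the disagreement after the mixing step at time \<open>k\<close>,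
  and \<open>Q = 2 * \<beta> / \<Gamma> * e - \<rho> * e\<^sup>2\<close> is the gain of a step without noise.  The initial disagreement uses up at most
  \<open>Q - q\<close>, and the bound on the stepsize keeps the errors quadratic in \<open>\<mu>\<close> below a tenth of
  the remaining \<open>\<mu> * q\<close>.
\<close>

lemma squared_rate_margin:
  fixes L \<beta> lam Lam \<gamma> u D s \<mu> a c q Q e E :: real
  assumes pos: "L > 0" "\<beta> > 0" "0 < lam" "lam < 1" "0 < \<gamma>" "u > 0" "c > 0" "D \<ge> 0" "s \<ge> 1" "\<mu> > 0"
    and lam_le: "lam \<le> Lam * \<gamma>"
    and a: "a = 2 * (L + \<beta>) * L / lam\<^sup>2"
    and step: "10 * s * (a * lam + L\<^sup>2 + a * u * Lam) * \<mu> \<le> q"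
    and q: "q = Q - 2 * (L + \<beta>) * c * D / (s * lam)"
    and rate: "e\<^sup>2 - 9 / 10 * \<mu> * q \<le> \<gamma>\<^sup>2 * e\<^sup>2"
    and E: "E = c * D + s * u * L * \<mu> / \<gamma>"
  shows "e\<^sup>2 - \<mu> * Q + 2 * \<mu> * (L + \<beta>) * E / s + L\<^sup>2 * \<mu>\<^sup>2 \<le> \<gamma>\<^sup>2 * e\<^sup>2"
proof -
  have a0: "0 < a" using pos by (simp add: a)
  have Lam: "0 < Lam"
    using less_le_trans[OF pos(3) lam_le] pos(5) by (simp add: zero_less_mult_iff)
  have "lam * lam \<le> lam * 1" using pos by (intro mult_left_mono) auto
  with lam_le have "lam\<^sup>2 \<le> Lam * \<gamma>" by (simp add: power2_eq_square)
  then have inv: "1 / \<gamma> \<le> Lam / lam\<^sup>2" using pos by (simp add: field_simps)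
  have "2 * (L + \<beta>) * L * u * (1 / \<gamma>) \<le> 2 * (L + \<beta>) * L * u * (Lam / lam\<^sup>2)"
    using pos by (intro mult_left_mono[OF inv]) auto
  then have noise: "2 * (L + \<beta>) * (u * L / \<gamma>) \<le> a * u * Lam" by (simp add: a mult_ac)
  have drift: "2 * (L + \<beta>) * c * D / s \<le> Q - q"
  proof -
    have "0 \<le> 2 * (L + \<beta>) * c * D / s" using pos by simp
    then have "2 * (L + \<beta>) * c * D / s \<le> 2 * (L + \<beta>) * c * D / s / lam"
      unfolding pos_le_divide_eq[OF pos(3)] using pos(4) by (intro mult_left_le) auto
    then show ?thesis by (simp add: q)
  qed
  have K: "10 * ((L\<^sup>2 + a * u * Lam) * \<mu>) \<le> q"
  proof -
    have "10 * ((L\<^sup>2 + a * u * Lam) * \<mu>) \<le> (10 * s) * ((a * lam + L\<^sup>2 + a * u * Lam) * \<mu>)"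
      using pos a0 Lam by (intro mult_mono) auto
    then show ?thesis using step by (simp add: mult_ac)
  qed
  have "2 * \<mu> * (L + \<beta>) * E / s
      = \<mu> * (2 * (L + \<beta>) * c * D / s) + \<mu> * (\<mu> * (2 * (L + \<beta>) * (u * L / \<gamma>)))"
    using pos by (simp add: E field_simps)
  also have "\<dots> \<le> \<mu> * (Q - q) + \<mu> * (\<mu> * (a * u * Lam))"
    using pos by (intro add_mono mult_left_mono drift noise) auto
  finally have "e\<^sup>2 - \<mu> * Q + 2 * \<mu> * (L + \<beta>) * E / s + L\<^sup>2 * \<mu>\<^sup>2
      \<le> e\<^sup>2 - \<mu> * q + \<mu> * ((L\<^sup>2 + a * u * Lam) * \<mu>)"
    by (simp add: algebra_simps power2_eq_square)
  moreover have "\<mu> * (10 * ((L\<^sup>2 + a * u * Lam) * \<mu>)) \<le> \<mu> * q"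
    using pos by (intro mult_left_mono K) auto
  ultimately show ?thesis using rate by linarith
qed

text \<open>
  Since \<open>\<beta> \<le> L\<close>, the disagreement and the subgradient step together are at most
  \<open>11 / 20 * (e / \<Gamma>)\<close>.  The constants \<open>11 / 20\<close> and \<open>99 / 100\<close> work because
  \<open>\<Gamma> + 11 / 20 \<le> 99 / 100 * \<Gamma>\<^sup>2\<close> for \<open>\<Gamma> \<ge> sqrt 2\<close>.
\<close>

lemma agent_rate_margin:
  fixes L \<beta> lam Lam \<gamma> u D s \<mu> a c q Q e E \<Gamma> :: real
  assumes pos: "\<beta> > 0" "0 < lam" "lam < 1" "0 < \<gamma>" "u > 0" "c > 0" "D \<ge> 0" "s \<ge> 1" "\<mu> > 0" "e > 0"
    and L: "\<beta> \<le> L"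
    and lam_le: "lam \<le> Lam * \<gamma>"
    and a: "a = 2 * (L + \<beta>) * L / lam\<^sup>2"
    and step: "10 * s * (a * lam + L\<^sup>2 + a * u * Lam) * \<mu> \<le> q"
    and q: "q \<le> Q"
    and D: "2 * (L + \<beta>) * c * D \<le> lam * Q"
    and Q: "Q \<le> 2 * \<beta> * e / \<Gamma>"
    and E: "E = c * D + s * u * L * \<mu> / \<gamma>"
    and \<Gamma>: "\<Gamma> \<ge> sqrt 2" and rate: "99 / 100 \<le> \<gamma>"
  shows "e + E + L * \<mu> \<le> \<Gamma> * (\<gamma> * e)"
proof -
  have L0: "0 < L" using pos L by simp
  have inv: "1 / \<gamma> \<le> Lam / lam" using pos lam_le by (simp add: field_simps)
  have "2 * (L + \<beta>) * L * u * (1 / \<gamma>) \<le> 2 * (L + \<beta>) * L * u * (Lam / lam)"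
    using pos L0 by (intro mult_left_mono[OF inv]) auto
  moreover have "lam * (a * lam) = 2 * (L + \<beta>) * L"
      "lam * (a * u * Lam) = 2 * (L + \<beta>) * L * u * (Lam / lam)"
    using pos by (simp_all add: a power2_eq_square)
  ultimately have "2 * (L + \<beta>) * (L + u * L / \<gamma>) \<le> lam * (a * lam + a * u * Lam)"
    by (simp add: distrib_left mult_ac)
  also have "\<dots> \<le> lam * (a * lam + L\<^sup>2 + a * u * Lam)"
    using pos by (intro mult_left_mono) auto
  finally have "(s * \<mu>) * (2 * (L + \<beta>) * (L + u * L / \<gamma>))
      \<le> (s * \<mu>) * (lam * (a * lam + L\<^sup>2 + a * u * Lam))"
    using pos by (intro mult_left_mono) auto
  also have "\<dots> = lam / 10 * (10 * s * (a * lam + L\<^sup>2 + a * u * Lam) * \<mu>)" by simp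
  also have "\<dots> \<le> lam / 10 * q" using pos by (intro mult_left_mono step) auto
  also have "\<dots> = lam * (q / 10)" by simp
  also have "\<dots> \<le> lam * (Q / 10)" using q pos by (intro mult_left_mono) auto
  finally have noise: "2 * (L + \<beta>) * (s * \<mu> * (L + u * L / \<gamma>)) \<le> lam * (Q / 10)"
    by (simp add: mult_ac)
  have "1 * (L * \<mu>) \<le> s * (L * \<mu>)" using pos L0 by (intro mult_right_mono) auto
  then have "E + L * \<mu> \<le> c * D + s * \<mu> * (L + u * L / \<gamma>)"
    by (simp add: E algebra_simps)
  then have "2 * (L + \<beta>) * (E + L * \<mu>) \<le> 2 * (L + \<beta>) * (c * D + s * \<mu> * (L + u * L / \<gamma>))"
    using L0 pos by (intro mult_left_mono) auto
  also have "\<dots> \<le> lam * Q + lam * (Q / 10)"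
    using D noise by (simp add: distrib_left mult_ac)
  also have "\<dots> = lam * (11 / 10 * Q)" by simp
  also have "\<dots> \<le> 1 * (11 / 10 * Q)"
  proof (rule mult_right_mono)
    have "0 \<le> 2 * (L + \<beta>) * c * D" using pos L0 by simp
    with D have "0 \<le> lam * Q" by linarith
    then show "0 \<le> 11 / 10 * Q" using pos by (simp add: zero_le_mult_iff)
  qed (use pos in auto)
  also have "\<dots> \<le> 11 / 10 * (2 * \<beta> * e / \<Gamma>)" using Q by simp
  finally have bound: "2 * (L + \<beta>) * (E + L * \<mu>) \<le> 11 / 10 * (2 * \<beta> * e / \<Gamma>)" .
  have \<Gamma>1: "\<Gamma> \<ge> 1414 / 1000"
  proof -
    have "1414 / 1000 \<le> sqrt 2" by (rule real_le_rsqrt) (simp add: power2_eq_square)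
    then show ?thesis using \<Gamma> by simp
  qed
  have E0: "0 \<le> E + L * \<mu>" using pos L0 by (simp add: E)
  have "2 * (2 * \<beta>) * (E + L * \<mu>) \<le> 2 * (L + \<beta>) * (E + L * \<mu>)"
    using E0 L by (intro mult_right_mono) auto
  with bound have "4 * \<beta> * (E + L * \<mu>) \<le> 4 * \<beta> * (11 / 20 * (e / \<Gamma>))" by simp
  then have small: "E + L * \<mu> \<le> 11 / 20 * (e / \<Gamma>)"
    by (rule mult_left_le_imp_le) (use pos in simp)
  have "\<Gamma> + 11 / 20 \<le> 99 / 100 * (\<Gamma> * \<Gamma>)"
  proof -
    have "1414 / 1000 * \<Gamma> \<le> \<Gamma> * \<Gamma>" using \<Gamma>1 by (intro mult_right_mono) auto
    then show ?thesis using \<Gamma>1 by linarith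
  qed
  also have "\<dots> \<le> \<gamma> * (\<Gamma> * \<Gamma>)" using rate by (intro mult_right_mono) auto
  finally have "(\<Gamma> + 11 / 20) * (e / \<Gamma>) \<le> \<gamma> * (\<Gamma> * \<Gamma>) * (e / \<Gamma>)"
    using \<Gamma>1 pos by (intro mult_right_mono) auto
  moreover have "(\<Gamma> + 11 / 20) * (e / \<Gamma>) = e + 11 / 20 * (e / \<Gamma>)"
      "\<gamma> * (\<Gamma> * \<Gamma>) * (e / \<Gamma>) = \<Gamma> * (\<gamma> * e)"
    using \<Gamma>1 by (simp_all add: field_simps)
  ultimately show ?thesis using small by linarith
qed

lemma powr_exponent_near_one:
  fixes b m :: real
  assumes "0 < b" "b < 1" "m < 1"
  obtains \<delta> where "\<delta> > 0" "m \<le> b powr \<delta>" "b powr \<delta> < 1"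
proof -
  obtain g where g: "max m 0 < g" "g < 1" using dense[of "max m 0" 1] assms by auto
  show ?thesis
  proof (rule that[of "ln g / ln b"])
    have "b powr (ln g / ln b) = g" using assms g by (simp add: powr_def)
    then show "m \<le> b powr (ln g / ln b)" "b powr (ln g / ln b) < 1" using g by auto
    show "ln g / ln b > 0" using assms g by (intro divide_neg_neg) auto
  qed
qed

section \<open>Linear convergence to a sharp minimizer\<close>

theorem mainTheorem3:
  fixes X :: "(real^'n) set"
    and F :: "'v::finite \<Rightarrow> real^'n \<Rightarrow> real"
    and A :: "nat \<Rightarrow> real^'v^'v"
    and x0 :: "real^'n^'v"
    and xs :: "real^'n"
    and N T\<^sub>0 :: nat
    and \<rho> L \<eta> c lam \<beta> B Lam \<Gamma> e0 a q \<mu>0 :: real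
  assumes "N = CARD('v)" and "N \<ge> 2"
    and "X \<noteq> {}" and "closed X" and "convex X"
    and A1: "0 < \<eta>" "\<eta> < 1" "\<forall>k i. A k $ i $ i \<ge> \<eta>"
      "\<forall>k i j. A k $ i $ j > 0 \<longrightarrow> A k $ i $ j \<ge> \<eta>"
    and A2: "\<forall>k. doubly_stochastic (A k)"
    and A3: "strongly_connected_on_UNIV (recurrent_edges A)"
    and A4: "T\<^sub>0 \<ge> 1" "\<forall>e \<in> recurrent_edges A. \<forall>k. e \<in> (\<Union>t<T\<^sub>0. comm_edges A (k + t))"
    and A5: "bdd_below (range (avg_objective F))"
      "\<rho> > 0" "\<forall>i. weakly_convex \<rho> (F i)"
      "\<forall>i. \<forall>x\<in>X. \<forall>g \<in> weak_subdifferential \<rho> (F i) x. norm g \<le> L"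
    and mixing: "c > 0" "0 < lam" "lam < 1"
      "\<forall>s k. s \<le> k \<longrightarrow>
         onorm ((*v) (transition_matrix A k s - averaging_matrix)) \<le> c * lam ^ (k - s)"
    and sharp: "local_sharp_minimizer (avg_objective F) X \<beta> B xs"
    and "lam < Lam" and "Lam < 1" and "\<Gamma> \<ge> sqrt 2"
    and e0: "e0 = min (max (\<beta> / (\<rho> * \<Gamma>)) (sqrt (1 / real N * (\<Sum>i\<in>UNIV. (norm (x0 $ i - xs))\<^sup>2))))
                      (B / \<Gamma>)"
    and a: "a = 2 * (L + \<beta>) * L / lam\<^sup>2"
    and q: "q = 2 * \<beta> / \<Gamma> * e0 - \<rho> * e0\<^sup>2
                - 2 * (L + \<beta>) * c / (sqrt (real N) * lam) * norm (consensus_error x0)"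
    and init: "\<forall>i. x0 $ i \<in> X"
      "(\<Sum>j\<in>UNIV. (norm (x0 $ j - xs))\<^sup>2) \<le> real N / \<Gamma>\<^sup>2 * min ((2 * \<beta> / \<rho>)\<^sup>2) (B\<^sup>2)"
      "\<forall>i. (norm (x0 $ i - xs))\<^sup>2 \<le> \<Gamma>\<^sup>2 / real N * (\<Sum>j\<in>UNIV. (norm (x0 $ j - xs))\<^sup>2)"
      "norm (consensus_error x0)
         < (2 / \<Gamma> * \<beta> * e0 - \<rho> * e0\<^sup>2) / (2 * (L + \<beta>) * c) * lam"
    and step: "0 < \<mu>0"
      "\<mu>0 \<le> min (e0 / (2 * \<beta> - \<rho> * e0))
                 (q / (10 * sqrt (real N) * (a * lam + L\<^sup>2 + a * c * Lam / (1 - Lam))))"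
  shows "\<exists>\<delta>>0. \<forall>(\<gamma>::real) x. \<gamma> = lam powr \<delta> \<longrightarrow>
           dpsm_sequence X A \<rho> F (\<lambda>k. \<mu>0 * \<gamma> ^ k) x0 x \<longrightarrow>
           (\<forall>k. (\<Sum>i\<in>UNIV. (norm (x k $ i - xs))\<^sup>2) \<le> real N * \<gamma> ^ (2 * k) * e0\<^sup>2 \<and>
                (\<forall>i. (norm (x k $ i - xs))\<^sup>2 \<le> \<Gamma>\<^sup>2 * \<gamma> ^ (2 * k) * e0\<^sup>2))"
proof -
  define f where "f = avg_objective F"
  define D where "D = norm (consensus_error x0)"
  define s where "s = sqrt (real N)"
  define Q where "Q = 2 * \<beta> / \<Gamma> * e0 - \<rho> * e0\<^sup>2"
  define u where "u = c / (1 - Lam)"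
  define S0 where "S0 = (\<Sum>i\<in>UNIV. (norm (x0 $ i - xs))\<^sup>2)"
  have \<beta>: "\<beta> > 0" and B: "B > 0" and xsX: "xs \<in> X"
    and fmin: "\<And>y. y \<in> X \<Longrightarrow> f xs \<le> f y"
    using sharp by (auto simp: local_sharp_minimizer_def is_arg_min_linorder f_def)
  have "(INF y\<in>X. f y) = f xs"
    using xsX fmin by (intro cInf_eq_minimum) auto
  then have sharp': "\<beta> * norm (y - xs) \<le> f y - f xs" if "y \<in> X" "norm (y - xs) \<le> B" for y
    using sharp that by (auto simp: local_sharp_minimizer_def f_def)
  have "1 \<le> sqrt 2" by simp
  then have \<Gamma>1: "\<Gamma> \<ge> 1" using \<open>\<Gamma> \<ge> sqrt 2\<close> by linarith
  have s: "s \<ge> 1" "s\<^sup>2 = real N" "s > 0" using \<open>N \<ge> 2\<close> by (auto simp: s_def)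
  have Lam: "0 < Lam" using \<open>lam < Lam\<close> mixing by simp
  have u: "u > 0" using mixing \<open>Lam < 1\<close> by (simp add: u_def)
  have D: "D \<ge> 0" by (simp add: D_def)
  have e0_pos: "e0 > 0"
    using \<beta> B \<Gamma>1 \<open>\<rho> > 0\<close> by (simp add: e0 less_max_iff_disj)
  have inX: "x k $ i \<in> X" if "dpsm_sequence X A \<rho> F \<alpha> x0 x" for \<alpha> x k i
  proof (cases k)
    case 0
    then show ?thesis using that init(1) by (simp add: dpsm_sequence_def)
  next
    case (Suc m)
    then show ?thesis
      using that closest_point_in_set[OF \<open>closed X\<close> \<open>X \<noteq> {}\<close>]
      unfolding dpsm_sequence_def by metis
  qed
  show ?thesis
  proof (cases "X = {xs}")
    case True
    \<comment> \<open>All iterates equal \<open>xs\<close>, so every exponent works.\<close>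
    have "(\<Sum>i\<in>UNIV. (norm (x k $ i - xs))\<^sup>2) \<le> real N * \<gamma> ^ (2 * k) * e0\<^sup>2 \<and>
        (\<forall>i. (norm (x k $ i - xs))\<^sup>2 \<le> \<Gamma>\<^sup>2 * \<gamma> ^ (2 * k) * e0\<^sup>2)"
      if "dpsm_sequence X A \<rho> F (\<lambda>k. \<mu>0 * \<gamma> ^ k) x0 x" for \<gamma> x k
    proof -
      have "x k $ i = xs" for i using inX[OF that] True by blast
      then show ?thesis by simp
    qed
    then show ?thesis by (meson zero_less_one)
  next
    case False
    have lipF: "F i z - L * norm (y - z) \<le> F i y" if "y \<in> X" "z \<in> X" for i y z
      by (rule weakly_convex_lipschitz[of X \<rho>]) (use that A5 \<open>convex X\<close> in auto)
    have "f y - f xs \<le> L * norm (y - xs)" if "y \<in> X" for y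
    proof -
      have "(\<Sum>i\<in>UNIV. F i y) \<le> (\<Sum>i\<in>UNIV. F i xs + L * norm (y - xs))"
        using lipF[OF xsX that] by (intro sum_mono) (simp add: norm_minus_commute algebra_simps)
      then show ?thesis by (simp add: f_def avg_objective_def sum.distrib field_simps)
    qed
    then have \<beta>L: "\<beta> \<le> L"
      using \<open>convex X\<close> xsX False B sharp' by (intro sharpness_le_lipschitz[of X xs B \<beta> f L])
    then have L: "L > 0" using \<beta> by simp
    have D_less: "2 * (L + \<beta>) * c * D < lam * Q"
      using init(4) L \<beta> mixing(1) by (simp add: D_def Q_def pos_less_divide_eq mult_ac)
    have "0 \<le> 2 * (L + \<beta>) * c * D" using L \<beta> mixing(1) D by simp
    with D_less have "0 < lam * Q" by linarith
    then have Q: "Q > 0" using mixing by (simp add: zero_less_mult_iff)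
    have Qq: "q = Q - 2 * (L + \<beta>) * c * D / (s * lam)"
      by (simp add: q Q_def D_def s_def)
    have q: "0 < q" "q \<le> Q"
    proof -
      have "2 * (L + \<beta>) * c * D / (s * lam) < lam * Q / (s * lam)"
        using D_less s mixing by (intro divide_strict_right_mono) auto
      also have "\<dots> = Q / s" using mixing by simp
      also have "\<dots> \<le> Q" using s Q by (simp add: pos_divide_le_eq)
      finally show "0 < q" by (simp add: Qq)
      show "q \<le> Q" using L \<beta> mixing D s by (simp add: Qq)
    qed
    have "a > 0" using L \<beta> mixing by (simp add: a)
    then have K: "0 < a * lam + L\<^sup>2 + a * u * Lam"
      using L mixing u Lam by (intro add_pos_pos) auto
    have "\<mu>0 \<le> q / (10 * s * (a * lam + L\<^sup>2 + a * u * Lam))"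
      using step(2) by (simp add: s_def u_def mult_ac)
    then have step_q: "10 * s * (a * lam + L\<^sup>2 + a * u * Lam) * \<mu>0 \<le> q"
      using K s by (simp add: pos_le_divide_eq mult_ac)
    \<comment> \<open>\<open>C\<close> is the factor of the squared distances in a noiseless step at time \<open>0\<close>; it dominates
      the factors at all later times.  The first bound on \<open>\<mu>0\<close> makes it nonnegative, which is
      needed to replace the squared distances by their upper bound.\<close>
    define C where "C = 1 + \<mu>0 * \<rho> - 2 * \<mu>0 * \<beta> / (\<Gamma> * e0)"
    have C: "0 \<le> C" "C * e0\<^sup>2 = e0\<^sup>2 - \<mu>0 * Q"
    proof -
      have "Q = e0 * (2 * \<beta> / \<Gamma> - \<rho> * e0)"
        by (simp add: Q_def power2_eq_square algebra_simps)
      then have "\<rho> * e0 < 2 * \<beta> / \<Gamma>"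
        using Q e0_pos by (simp add: zero_less_mult_iff)
      also have "\<dots> \<le> 2 * \<beta>" using \<Gamma>1 \<beta> by (simp add: pos_divide_le_eq)
      finally have "2 * \<beta> - \<rho> * e0 > 0" by simp
      then have "\<mu>0 * (2 * \<beta> - \<rho> * e0) \<le> e0" using step(2) by (simp add: pos_le_divide_eq)
      then have "2 * \<mu>0 * \<beta> / e0 \<le> 1 + \<mu>0 * \<rho>" using e0_pos by (simp add: field_simps)
      moreover have "2 * \<mu>0 * \<beta> / (\<Gamma> * e0) \<le> 2 * \<mu>0 * \<beta> / e0"
        using \<Gamma>1 e0_pos \<beta> step(1) by (intro divide_left_mono) auto
      ultimately show "0 \<le> C" by (simp add: C_def)
      show "C * e0\<^sup>2 = e0\<^sup>2 - \<mu>0 * Q"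
        using \<Gamma>1 e0_pos by (simp add: C_def Q_def field_simps power2_eq_square)
    qed
    have "e0 \<le> B / \<Gamma>" unfolding e0 by (rule min.cobounded2)
    then have e0B: "\<Gamma> * e0 \<le> B" using \<Gamma>1 by (simp add: pos_le_divide_eq mult.commute)
    have S0: "S0 \<le> real N * e0\<^sup>2"
    proof -
      have "S0 / real N \<le> (B / \<Gamma>)\<^sup>2"
      proof -
        have "S0 \<le> real N / \<Gamma>\<^sup>2 * min ((2 * \<beta> / \<rho>)\<^sup>2) (B\<^sup>2)"
          using init(2) by (simp only: S0_def)
        also have "\<dots> \<le> real N / \<Gamma>\<^sup>2 * B\<^sup>2" by (intro mult_left_mono) auto
        finally show ?thesis using \<open>N \<ge> 2\<close> by (simp add: power_divide field_simps)
      qed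
      then have "sqrt (S0 / real N) \<le> B / \<Gamma>"
        using B \<Gamma>1 by (intro real_le_lsqrt) auto
      then have "sqrt (S0 / real N) \<le> e0" by (simp add: e0 S0_def)
      then have "S0 / real N \<le> e0\<^sup>2" by (simp add: sqrt_le_D)
      then show ?thesis using \<open>N \<ge> 2\<close> by (simp add: field_simps)
    qed
    \<comment> \<open>All constraints on the rate are lower bounds less than \<open>1\<close>, so a small exponent meets them.\<close>
    have "max (lam / Lam) (max (99 / 100) (sqrt (1 - 9 / 10 * \<mu>0 * q / e0\<^sup>2))) < 1"
      using \<open>lam < Lam\<close> Lam q step(1) e0_pos by simp
    then obtain \<delta> where \<delta>: "\<delta> > 0"
      "max (lam / Lam) (max (99 / 100) (sqrt (1 - 9 / 10 * \<mu>0 * q / e0\<^sup>2))) \<le> lam powr \<delta>"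
      "lam powr \<delta> < 1"
      using powr_exponent_near_one mixing by metis
    define \<gamma> where "\<gamma> = lam powr \<delta>"
    have \<gamma>: "0 < \<gamma>" "\<gamma> < 1" "99 / 100 \<le> \<gamma>" using \<delta> mixing by (auto simp: \<gamma>_def)
    have lam_le: "lam \<le> Lam * \<gamma>" "lam \<le> \<gamma>"
    proof -
      show "lam \<le> Lam * \<gamma>" using \<delta>(2) Lam by (simp add: \<gamma>_def field_simps)
      also have "\<dots> \<le> \<gamma>" using \<open>Lam < 1\<close> \<gamma> by simp
      finally show "lam \<le> \<gamma>" .
    qed
    have "1 - 9 / 10 * \<mu>0 * q / e0\<^sup>2 \<le> \<gamma>\<^sup>2"
      using \<delta>(2) by (intro sqrt_le_D) (simp add: \<gamma>_def)
    then have rate: "e0\<^sup>2 - 9 / 10 * \<mu>0 * q \<le> \<gamma>\<^sup>2 * e0\<^sup>2"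
      using e0_pos by (simp add: field_simps)
    define E where "E = c * D + s * u * L * \<mu>0 / \<gamma>"
    have "Q \<le> 2 * \<beta> * e0 / \<Gamma>" using \<open>\<rho> > 0\<close> by (simp add: Q_def)
    then have agent_margin: "e0 + E + L * \<mu>0 \<le> \<Gamma> * (\<gamma> * e0)"
      using agent_rate_margin[OF \<beta> mixing(2,3) \<gamma>(1) u mixing(1) D s(1) step(1) e0_pos \<beta>L lam_le(1) a
          step_q q(2) _ _ E_def \<open>\<Gamma> \<ge> sqrt 2\<close> \<gamma>(3)] D_less by simp
    have sum_margin: "e0\<^sup>2 - \<mu>0 * Q + 2 * \<mu>0 * (L + \<beta>) * E / s + L\<^sup>2 * \<mu>0\<^sup>2 \<le> \<gamma>\<^sup>2 * e0\<^sup>2"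
      by (rule squared_rate_margin[OF L \<beta> mixing(2,3) \<gamma>(1) u mixing(1) D s(1) step(1) lam_le(1) a
            step_q Qq rate E_def])
    have "(\<Sum>i\<in>UNIV. (norm (x k $ i - xs))\<^sup>2) \<le> real N * \<gamma> ^ (2 * k) * e0\<^sup>2 \<and>
        (\<forall>i. (norm (x k $ i - xs))\<^sup>2 \<le> \<Gamma>\<^sup>2 * \<gamma> ^ (2 * k) * e0\<^sup>2)"
      if seq: "dpsm_sequence X A \<rho> F (\<lambda>k. \<mu>0 * \<gamma> ^ k) x0 x" for x k
    proof -
      have ds: "doubly_stochastic (A k)" for k using A2 by blast
      define v where "v k = block_mult (A k) (x k)" for k
      have mp: "mixed_point (A k) (x k) i = v k $ i" for k i
        by (simp add: v_def mixed_point_eq_block_mult[OF ds])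
      have vX: "v k $ i \<in> X" for k i
        unfolding v_def using inX[OF seq] by (intro block_mult_mem_convex ds \<open>convex X\<close>)
      have "\<forall>k i. \<exists>g. g \<in> weak_subdifferential \<rho> (F i) (v k $ i) \<and>
          x (Suc k) $ i = closest_point X (v k $ i - (\<mu>0 * \<gamma> ^ k) *\<^sub>R g)"
        using seq unfolding dpsm_sequence_def mp by blast
      then obtain g where g: "\<And>k i. g k i \<in> weak_subdifferential \<rho> (F i) (v k $ i)"
        and x_Suc: "\<And>k i. x (Suc k) $ i = closest_point X (v k $ i - (\<mu>0 * \<gamma> ^ k) *\<^sub>R g k i)"
        by metis
      have g_le: "norm (g k i) \<le> L" for k i using A5(4) g vX by blast
      define p where "p k = x (Suc k) - v k" for k
      have p_le: "norm (p k $ i) \<le> L * \<mu>0 * \<gamma> ^ k" for k i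
      proof -
        have "norm (p k $ i) \<le> norm ((\<mu>0 * \<gamma> ^ k) *\<^sub>R g k i)"
          using closest_point_lipschitz[OF \<open>convex X\<close> \<open>closed X\<close> \<open>X \<noteq> {}\<close>,
              of "v k $ i - (\<mu>0 * \<gamma> ^ k) *\<^sub>R g k i" "v k $ i"]
          by (simp add: p_def x_Suc closest_point_self vX dist_norm)
        also have "\<dots> = (\<mu>0 * \<gamma> ^ k) * norm (g k i)" using step(1) \<gamma> by simp
        also have "\<dots> \<le> (\<mu>0 * \<gamma> ^ k) * L"
          using step(1) \<gamma> by (intro mult_left_mono g_le) auto
        finally show ?thesis by (simp add: mult_ac)
      qed
      define m where "m k = block_mean (x k)" for k
      define dev where "dev k = v k - block_mult averaging_matrix (x k)" for k
      have dev_nth: "dev k $ i = v k $ i - m k" for k i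
        by (simp add: dev_def m_def block_mult_averaging_matrix del: block_mult_nth)
      have dev_le: "norm (dev k) \<le> \<gamma> ^ k * E" for k
      proof -
        have "norm (dev k) \<le> c * lam ^ k * norm (consensus_error (x 0))
             + (\<Sum>l<k. c * lam ^ (k - Suc l) * norm (p l))"
          unfolding dev_def v_def
          by (rule disagreement_bound[OF ds]) (use mixing(4) in \<open>auto simp: p_def v_def\<close>)
        also have "\<dots> \<le> c * \<gamma> ^ k * D
             + (\<Sum>l<k. c * lam ^ (k - Suc l) * (s * (L * \<mu>0 * \<gamma> ^ l)))"
        proof (intro add_mono sum_mono)
          show "c * lam ^ k * norm (consensus_error (x 0)) \<le> c * \<gamma> ^ k * D"
            using seq mixing lam_le by (auto simp: D_def dpsm_sequence_def intro!: mult_mono power_mono)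
          show "c * lam ^ (k - Suc l) * norm (p l) \<le> c * lam ^ (k - Suc l) * (s * (L * \<mu>0 * \<gamma> ^ l))" for l
            using norm_vec_le_of_blocks[of "p l", OF p_le] mixing
            by (intro mult_left_mono) (auto simp: s_def \<open>N = CARD('v)\<close>)
        qed
        also have "(\<Sum>l<k. c * lam ^ (k - Suc l) * (s * (L * \<mu>0 * \<gamma> ^ l)))
            = c * s * L * \<mu>0 * (\<Sum>l<k. lam ^ (k - Suc l) * \<gamma> ^ l)"
          by (simp add: sum_distrib_left mult_ac)
        also have "\<dots> \<le> c * s * L * \<mu>0 * (\<gamma> ^ k / (\<gamma> * (1 - Lam)))"
          using mixing s L step(1) \<gamma> lam_le \<open>Lam < 1\<close>
          by (intro mult_left_mono geometric_convolution_le) auto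
        also have "c * \<gamma> ^ k * D + \<dots> = \<gamma> ^ k * E"
          by (simp add: E_def u_def algebra_simps)
        finally show ?thesis by simp
      qed
      show ?thesis
      proof (induction k)
        case 0
        have "(norm (x0 $ i - xs))\<^sup>2 \<le> \<Gamma>\<^sup>2 * e0\<^sup>2" for i
        proof -
          have "(norm (x0 $ i - xs))\<^sup>2 \<le> \<Gamma>\<^sup>2 / real N * S0"
            using init(3) by (simp add: S0_def)
          also have "\<dots> \<le> \<Gamma>\<^sup>2 / real N * (real N * e0\<^sup>2)" by (intro mult_left_mono S0) auto
          finally show ?thesis using \<open>N \<ge> 2\<close> by simp
        qed
        then show ?case using S0 seq by (simp add: S0_def dpsm_sequence_def)
      next
        case (Suc k)
        let ?S = "\<Sum>i\<in>UNIV. (norm (x k $ i - xs))\<^sup>2"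
        let ?V = "\<Sum>i\<in>UNIV. (norm (v k $ i - xs))\<^sup>2"
        define R where "R = \<Gamma> * (\<gamma> ^ k * e0)"
        have R: "R > 0" using \<Gamma>1 \<gamma> e0_pos by (simp add: R_def)
        have gk: "0 < \<gamma> ^ k" "\<gamma> ^ k \<le> 1" using \<gamma> by (auto intro: power_le_one)
        have S: "?S \<le> real N * (\<gamma> ^ k * e0)\<^sup>2"
          using Suc by (simp add: power_mult_distrib power_mult[symmetric] mult_ac)
        have VS: "?V \<le> ?S" unfolding v_def by (rule sum_block_mult_distance_le[OF ds])
        have x_R: "norm (x k $ i - xs) \<le> R" for i
        proof (rule power2_le_imp_le)
          have "\<Gamma>\<^sup>2 * \<gamma> ^ (2 * k) * e0\<^sup>2 = R\<^sup>2"
            by (simp add: R_def power_mult_distrib power_mult[symmetric] mult_ac)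
          then show "(norm (x k $ i - xs))\<^sup>2 \<le> R\<^sup>2" using Suc by metis
        qed (use R in simp)
        have v_R: "norm (v k $ i - xs) \<le> R" for i
          using block_mult_mem_convex[OF ds convex_cball[of xs R], of "x k" k i] x_R
          by (simp add: v_def dist_norm norm_minus_commute)
        have mX: "m k \<in> X"
          using block_mult_mem_convex[OF doubly_stochastic_averaging_matrix \<open>convex X\<close> inX[OF seq]]
          unfolding block_mult_averaging_matrix m_def .
        have m_near: "norm (m k - xs) \<le> \<gamma> ^ k * e0"
        proof (rule power2_le_imp_le)
          have "real N * (norm (m k - xs))\<^sup>2 \<le> ?S"
            unfolding m_def \<open>N = CARD('v)\<close> by (rule block_mean_distance_le)
          also note S
          finally have "real N * (norm (m k - xs))\<^sup>2 \<le> real N * (\<gamma> ^ k * e0)\<^sup>2" .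
          then show "(norm (m k - xs))\<^sup>2 \<le> (\<gamma> ^ k * e0)\<^sup>2" using \<open>N \<ge> 2\<close> by simp
        qed (use gk e0_pos in simp)
        have "\<gamma> ^ k * e0 \<le> 1 * e0" using gk e0_pos by (intro mult_right_mono) auto
        also have "\<dots> \<le> \<Gamma> * e0" using \<Gamma>1 e0_pos by (intro mult_right_mono) auto
        finally have "norm (m k - xs) \<le> B" using m_near e0B by linarith
        then have m_sharp: "\<beta> * norm (m k - xs) \<le> avg_objective F (m k) - avg_objective F xs"
          using sharp'[OF mX] by (simp add: f_def)
        have "(\<Sum>i\<in>UNIV. (norm (x (Suc k) $ i - xs))\<^sup>2)
          \<le> (1 + (\<mu>0 * \<gamma> ^ k) * \<rho> - 2 * (\<mu>0 * \<gamma> ^ k) * \<beta> / R) * ?V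
            + 2 * (\<mu>0 * \<gamma> ^ k) * (L + \<beta>) * (\<Sum>i\<in>UNIV. norm (v k $ i - m k))
            + real CARD('v) * ((\<mu>0 * \<gamma> ^ k)\<^sup>2 * L\<^sup>2)"
        proof (rule descent_step[OF \<open>closed X\<close> \<open>convex X\<close> _ _ _ xsX mX vX g x_Suc _ _ R m_sharp v_R])
          show "weakly_convex \<rho> (F i)" for i using A5(3) by blast
          show "norm h \<le> L" if "z \<in> X" "h \<in> weak_subdifferential \<rho> (F i) z" for i z h
            using A5(4) that by blast
        qed (use A5(2) step(1) \<gamma> \<beta> in auto)
        also have "\<dots> \<le> C * (real N * (\<gamma> ^ k * e0)\<^sup>2)
            + 2 * (\<mu>0 * \<gamma> ^ k) * (L + \<beta>) * (s * (\<gamma> ^ k * E)) + real N * ((\<mu>0 * \<gamma> ^ k)\<^sup>2 * L\<^sup>2)"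
        proof (intro add_mono)
          \<comment> \<open>The stepsize and the radius \<open>R\<close> decay at the same rate, so the gain is constant in \<open>k\<close>.\<close>
          have "(\<mu>0 * \<gamma> ^ k) * \<rho> \<le> \<mu>0 * \<rho>"
            using gk step(1) A5(2) by (intro mult_right_mono mult_left_le) auto
          moreover have "2 * (\<mu>0 * \<gamma> ^ k) * \<beta> / R = 2 * \<mu>0 * \<beta> / (\<Gamma> * e0)"
            using \<gamma> by (simp add: R_def)
          ultimately have "1 + (\<mu>0 * \<gamma> ^ k) * \<rho> - 2 * (\<mu>0 * \<gamma> ^ k) * \<beta> / R \<le> C"
            by (simp add: C_def)
          then show "(1 + (\<mu>0 * \<gamma> ^ k) * \<rho> - 2 * (\<mu>0 * \<gamma> ^ k) * \<beta> / R) * ?V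
              \<le> C * (real N * (\<gamma> ^ k * e0)\<^sup>2)"
            using C(1) VS S by (intro mult_mono) (auto intro: sum_nonneg)
          have "(\<Sum>i\<in>UNIV. norm (v k $ i - m k)) \<le> s * norm (dev k)"
            using sum_norm_blocks_le[of "dev k"] by (simp add: dev_nth s_def \<open>N = CARD('v)\<close>)
          also have "\<dots> \<le> s * (\<gamma> ^ k * E)" using s by (intro mult_left_mono dev_le) auto
          finally show "2 * (\<mu>0 * \<gamma> ^ k) * (L + \<beta>) * (\<Sum>i\<in>UNIV. norm (v k $ i - m k))
              \<le> 2 * (\<mu>0 * \<gamma> ^ k) * (L + \<beta>) * (s * (\<gamma> ^ k * E))"
            using L \<beta> step(1) gk by (intro mult_left_mono) auto
        qed (simp add: \<open>N = CARD('v)\<close>)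
        also have "\<dots> = real N * (\<gamma> ^ k)\<^sup>2 *
            (C * e0\<^sup>2 + 2 * \<mu>0 * (L + \<beta>) * E / s + L\<^sup>2 * \<mu>0\<^sup>2)"
          using s(3) unfolding s(2)[symmetric] by (simp add: power2_eq_square field_simps)
        also have "\<dots> \<le> real N * (\<gamma> ^ k)\<^sup>2 * (\<gamma>\<^sup>2 * e0\<^sup>2)"
          using sum_margin unfolding C(2) by (intro mult_left_mono) auto
        also have "\<dots> = real N * \<gamma> ^ (2 * Suc k) * e0\<^sup>2"
          unfolding power_even_eq by (simp add: power_mult_distrib mult_ac)
        finally have sum_bound:
          "(\<Sum>i\<in>UNIV. (norm (x (Suc k) $ i - xs))\<^sup>2) \<le> real N * \<gamma> ^ (2 * Suc k) * e0\<^sup>2" .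
        have "(norm (x (Suc k) $ i - xs))\<^sup>2 \<le> \<Gamma>\<^sup>2 * \<gamma> ^ (2 * Suc k) * e0\<^sup>2" for i
        proof -
          have "x (Suc k) $ i - xs = (m k - xs) + dev k $ i + p k $ i"
            by (simp add: dev_nth p_def)
          also have "norm \<dots> \<le> \<gamma> ^ k * e0 + \<gamma> ^ k * E + L * \<mu>0 * \<gamma> ^ k"
            using order_trans[OF Finite_Cartesian_Product.norm_nth_le dev_le]
            by (intro norm_triangle_le add_mono m_near p_le) auto
          also have "\<dots> = \<gamma> ^ k * (e0 + E + L * \<mu>0)" by (simp add: algebra_simps)
          also have "\<dots> \<le> \<gamma> ^ k * (\<Gamma> * (\<gamma> * e0))" using gk agent_margin by (intro mult_left_mono) auto
          finally have "(norm (x (Suc k) $ i - xs))\<^sup>2 \<le> (\<gamma> ^ k * (\<Gamma> * (\<gamma> * e0)))\<^sup>2"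
            by (intro power_mono) auto
          then show ?thesis
            unfolding power_even_eq by (simp add: power_mult_distrib mult_ac)
        qed
        with sum_bound show ?case by blast
      qed
    qed
    then show ?thesis using \<delta>(1) by (auto simp: \<gamma>_def intro!: exI[of _ \<delta>])
  qed
qed

end
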